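(* Let $(\phi_N)_{N\ge 1}$ be a sequence of compactly supported distributions on $\mathbb{R}$ with $\widehat{\phi}_N(0)=1$, with mean $\mu_N\in\mathbb{R}$ and variance $\sigma_N^2$, $\sigma_N>0$, and let $\tilde\phi_N(x)=\sigma_N\phi_N(\sigma_N x+\mu_N)$ be their standardized forms. Suppose that there exists a constant $r>0$ such that for every $\varepsilon>0$ there is an $N_0$ such that for all $N>N_0$ $$\left|\widehat{\tilde\phi}_N(iz)-e^{z^2/2}\right|\le \varepsilon \qquad\text{for all } z\in\mathbb{C},\ |z|<r .$$ Let $\{\tilde P_{N,m}: m=0,1,\dots\}$ be the polynomials generated by $\tilde\phi_N$, i.e. defined for $z$ in a neighborhood of $0$ by $$\frac{e^{xz}}{\widehat{\tilde\phi}_N(iz)}=\sum_{m=0}^\infty \frac{\tilde P_{N,m}(x)}{m!}z^m .$$ Then for each $m=0,1,2,\dots$, $\tilde P_{N,m}(x)$ converges to the Hermite polynomial $H_m(x)$ locally uniformly in $x\in\mathbb{R}$ as $N\to\infty$.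
   Context: The Hermite polynomials $H_m$ are normalized by $e^{xz-z^2/2}=\sum_{m\ge 0}\frac{H_m(x)}{m!}z^m$. For a compactly supported distribution $\phi$ on $\mathbb{R}$ (a continuous linear functional on $C^\infty(\mathbb{R})$, with compactly supported integrable functions and measures as special cases), $\widehat\phi$ is the Fourier transform $\widehat\phi(\omega)=\langle\phi,e^{-i\omega(\cdot)}\rangle$, extended to an entire function, so that $\widehat\phi(iz)=\langle \phi,e^{(\cdot)z}\rangle$ for $z\in\mathbb{C}$. Mean and variance of $\phi$ (when $\widehat\phi(0)=1$) are $\mu=\langle\phi,x\rangle$ and $\sigma^2=\langle\phi,(x-\mu)^2\rangle$. The standardized form $\tilde\phi(x)=\sigma\phi(\sigma x+\mu)$ is understood for distributions as $\langle\tilde\phi,\nu\rangle=\langle\phi,\nu((\cdot-\mu)/\sigma)\rangle$. *)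

theory Defs
  imports "HOL-Complex_Analysis.Complex_Analysis"
begin

section \<open>Smooth functions and compactly supported distributions on the real line\<close>

definition vderiv :: "nat \<Rightarrow> (real \<Rightarrow> complex) \<Rightarrow> real \<Rightarrow> complex" where
  "vderiv n = (\<lambda>f x. vector_derivative f (at x)) ^^ n"

definition smooth :: "(real \<Rightarrow> complex) \<Rightarrow> bool" where
  "smooth f \<longleftrightarrow> (\<forall>n x. vderiv n f differentiable (at x))"

text \<open>The usual Frechet topology of smooth functions: uniform convergence of finitely many
  derivatives on compact sets.\<close>

definition smooth_open :: "(real \<Rightarrow> complex) set \<Rightarrow> bool" where
  "smooth_open U \<longleftrightarrow> U \<subseteq> Collect smooth \<and>
     (\<forall>f\<in>U. \<exists>k K e. compact K \<and> e > 0 \<and>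
        (\<forall>g. smooth g \<and> (\<forall>j\<le>k. \<forall>x\<in>K. norm (vderiv j g x - vderiv j f x) < e) \<longrightarrow> g \<in> U))"

definition smooth_topology :: "(real \<Rightarrow> complex) topology" where
  "smooth_topology = topology smooth_open"

lemma istopology_smooth_open: "istopology smooth_open"
  unfolding istopology_def
proof (intro conjI allI impI)
  fix U V assume U: "smooth_open U" and V: "smooth_open V"
  show "smooth_open (U \<inter> V)"
    unfolding smooth_open_def
  proof (intro conjI ballI)
    show "U \<inter> V \<subseteq> Collect smooth" using U by (auto simp: smooth_open_def)
  next
    fix f assume f: "f \<in> U \<inter> V"
    from f U obtain k K e where 1: "compact K" "e > 0"
      "\<And>g. smooth g \<Longrightarrow> (\<And>j x. j \<le> k \<Longrightarrow> x \<in> K \<Longrightarrow> norm (vderiv j g x - vderiv j f x) < e) \<Longrightarrow> g \<in> U"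
      unfolding smooth_open_def by (metis IntD1)
    from f V obtain k' K' e' where 2: "compact K'" "e' > 0"
      "\<And>g. smooth g \<Longrightarrow> (\<And>j x. j \<le> k' \<Longrightarrow> x \<in> K' \<Longrightarrow> norm (vderiv j g x - vderiv j f x) < e') \<Longrightarrow> g \<in> V"
      unfolding smooth_open_def by (metis IntD2)
    show "\<exists>k K e. compact K \<and> e > 0 \<and>
        (\<forall>g. smooth g \<and> (\<forall>j\<le>k. \<forall>x\<in>K. norm (vderiv j g x - vderiv j f x) < e) \<longrightarrow> g \<in> U \<inter> V)"
      by (rule exI[of _ "max k k'"], rule exI[of _ "K \<union> K'"], rule exI[of _ "min e e'"])
         (use 1 2 in auto)
  qed
next
  fix \<U> assume *: "\<forall>U\<in>\<U>. smooth_open U"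
  show "smooth_open (\<Union>\<U>)"
    unfolding smooth_open_def
  proof (intro conjI ballI)
    show "\<Union>\<U> \<subseteq> Collect smooth" using * by (auto simp: smooth_open_def)
  next
    fix f assume "f \<in> \<Union>\<U>"
    then obtain U where U: "f \<in> U" "U \<in> \<U>" by blast
    with * obtain k K e where "compact K" "e > 0"
      "\<forall>g. smooth g \<and> (\<forall>j\<le>k. \<forall>x\<in>K. norm (vderiv j g x - vderiv j f x) < e) \<longrightarrow> g \<in> U"
      unfolding smooth_open_def by meson
    with U(2) show "\<exists>k K e. compact K \<and> e > 0 \<and>
        (\<forall>g. smooth g \<and> (\<forall>j\<le>k. \<forall>x\<in>K. norm (vderiv j g x - vderiv j f x) < e) \<longrightarrow> g \<in> \<Union>\<U>)"
      by (intro exI[of _ k] exI[of _ K] exI[of _ e]) auto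
  qed
qed

lemma openin_smooth_topology: "openin smooth_topology U \<longleftrightarrow> smooth_open U"
  by (simp add: smooth_topology_def topology_inverse' istopology_smooth_open)

lemma topspace_smooth_topology: "topspace smooth_topology = Collect smooth"
proof -
  have "smooth_open (Collect smooth)"
    unfolding smooth_open_def using compact_empty zero_less_one by blast
  then show ?thesis
    unfolding topspace_def openin_smooth_topology by (auto simp: smooth_open_def)
qed

text \<open>The values of \<open>\<phi>\<close> on non-smooth functions are irrelevant.\<close>

definition cs_distribution :: "((real \<Rightarrow> complex) \<Rightarrow> complex) \<Rightarrow> bool" where
  "cs_distribution \<phi> \<longleftrightarrow>
     (\<forall>f g. smooth f \<longrightarrow> smooth g \<longrightarrow> \<phi> (\<lambda>x. f x + g x) = \<phi> f + \<phi> g) \<and>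
     (\<forall>c f. smooth f \<longrightarrow> \<phi> (\<lambda>x. c * f x) = c * \<phi> f) \<and>
     continuous_map smooth_topology euclidean \<phi>"

text \<open>The argument is complex: this is the entire extension of the Fourier transform.\<close>

definition dist_fourier :: "((real \<Rightarrow> complex) \<Rightarrow> complex) \<Rightarrow> complex \<Rightarrow> complex" where
  "dist_fourier \<phi> \<omega> = \<phi> (\<lambda>x. exp (- \<i> * \<omega> * of_real x))"

definition dist_mean :: "((real \<Rightarrow> complex) \<Rightarrow> complex) \<Rightarrow> complex" where
  "dist_mean \<phi> = \<phi> (\<lambda>x. of_real x)"

definition dist_variance :: "((real \<Rightarrow> complex) \<Rightarrow> complex) \<Rightarrow> complex" where
  "dist_variance \<phi> = \<phi> (\<lambda>x. (of_real x - dist_mean \<phi>)\<^sup>2)"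

text \<open>\<open>standardize \<mu> \<sigma> \<phi>\<close> is \<open>\<sigma> \<phi>(\<sigma> x + \<mu>)\<close> in the sense of distributions.\<close>

definition standardize ::
    "real \<Rightarrow> real \<Rightarrow> ((real \<Rightarrow> complex) \<Rightarrow> complex) \<Rightarrow> (real \<Rightarrow> complex) \<Rightarrow> complex" where
  "standardize \<mu> \<sigma> \<phi> \<nu> = \<phi> (\<lambda>x. \<nu> ((x - \<mu>) / \<sigma>))"


section \<open>Generated polynomials, Hermite polynomials\<close>

text \<open>The coefficients are complex because a distribution may take complex values on real
  functions.\<close>

definition generates_polys :: "((real \<Rightarrow> complex) \<Rightarrow> complex) \<Rightarrow> (nat \<Rightarrow> complex poly) \<Rightarrow> bool" where
  "generates_polys \<phi> P \<longleftrightarrow>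
     (\<forall>x::real. \<forall>\<^sub>F z in nhds (0::complex).
        (\<lambda>m. poly (P m) (of_real x) / fact m * z ^ m) sums
          (exp (of_real x * z) / dist_fourier \<phi> (\<i> * z)))"

definition hermite_gf :: "(nat \<Rightarrow> real poly) \<Rightarrow> bool" where
  "hermite_gf H \<longleftrightarrow>
     (\<forall>(x::real) (z::complex).
        (\<lambda>m. of_real (poly (H m) x) / fact m * z ^ m) sums exp (of_real x * z - z\<^sup>2 / 2))"

definition hermite :: "nat \<Rightarrow> real poly" where
  "hermite = (THE H. hermite_gf H)"

lemma hermite_gf_exists: "\<exists>H. hermite_gf H"
proof -
  define e :: "nat \<Rightarrow> real" where
    "e n = (if even n then (- 1 / 2) ^ (n div 2) / fact (n div 2) else 0)" for n
  define H :: "nat \<Rightarrow> real poly" where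
    "H m = (\<Sum>i\<le>m. monom (fact m / fact i * e (m - i)) i)" for m
  have e_sums: "(\<lambda>n. of_real (e n) * z ^ n) sums exp (- z\<^sup>2 / 2)" for z :: complex
  proof -
    have "(\<lambda>n. (- z\<^sup>2 / 2) ^ n /\<^sub>R fact n) sums exp (- z\<^sup>2 / 2)" by (rule exp_converges)
    moreover have "(- z\<^sup>2 / 2) ^ n /\<^sub>R fact n = of_real (e (2 * n)) * z ^ (2 * n)" for n
    proof -
      have "- z\<^sup>2 / 2 = (- 1 / 2) * z\<^sup>2" by simp
      then have "(- z\<^sup>2 / 2) ^ n = (- 1 / 2) ^ n * z ^ (2 * n)"
        by (simp only: power_mult_distrib power_mult)
      then show ?thesis
        by (simp add: e_def scaleR_conv_of_real field_simps)
    qed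
    ultimately have "(\<lambda>n. of_real (e (2 * n)) * z ^ (2 * n)) sums exp (- z\<^sup>2 / 2)" by simp
    moreover have "strict_mono (\<lambda>n::nat. 2 * n)" by (simp add: strict_mono_def)
    ultimately show ?thesis
      by (subst (asm) sums_mono_reindex[of "\<lambda>n. 2 * n" "\<lambda>n. of_real (e n) * z ^ n"])
         (auto simp: e_def elim!: evenE)
  qed
  have "hermite_gf H"
    unfolding hermite_gf_def
  proof (intro allI)
    fix x :: real and z :: complex
    let ?a = "\<lambda>n. (of_real x * z) ^ n /\<^sub>R fact n"
    let ?b = "\<lambda>n. of_real (e n) * z ^ n"
    have a: "summable (\<lambda>n. norm (?a n))" by (rule summable_norm_exp)
    have "summable (\<lambda>n. of_real (e n) * (of_real (norm z + 1)) ^ n :: complex)"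
      using e_sums sums_summable by blast
    then have b: "summable (\<lambda>n. norm (?b n))"
      by (rule powser_insidea) (simp add: norm_of_real del: of_real_add)
    have "(\<lambda>m. \<Sum>i\<le>m. ?a i * ?b (m - i)) sums ((\<Sum>n. ?a n) * (\<Sum>n. ?b n))"
      by (rule Cauchy_product_sums[OF a b])
    also have "(\<Sum>n. ?a n) = exp (of_real x * z)"
      using exp_converges sums_unique by metis
    also have "(\<Sum>n. ?b n) = exp (- z\<^sup>2 / 2)"
      using e_sums sums_unique by metis
    also have "exp (of_real x * z) * exp (- z\<^sup>2 / 2) = exp (of_real x * z - z\<^sup>2 / 2)"
      by (simp flip: exp_add)
    also have "(\<lambda>m. \<Sum>i\<le>m. ?a i * ?b (m - i)) = (\<lambda>m. of_real (poly (H m) x) / fact m * z ^ m)"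
    proof
      fix m
      have "?a i * ?b (m - i) = of_real (fact m / fact i * e (m - i) * x ^ i) / fact m * z ^ m"
        if "i \<le> m" for i
      proof -
        have "z ^ m = z ^ i * z ^ (m - i)" using that by (simp flip: power_add)
        then show ?thesis
          by (simp add: scaleR_conv_of_real field_simps power_mult_distrib)
      qed
      then show "(\<Sum>i\<le>m. ?a i * ?b (m - i)) = of_real (poly (H m) x) / fact m * z ^ m"
        by (simp add: H_def poly_sum poly_monom sum_distrib_right sum_divide_distrib)
    qed
    finally show "(\<lambda>m. of_real (poly (H m) x) / fact m * z ^ m) sums exp (of_real x * z - z\<^sup>2 / 2)" .
  qed
  then show ?thesis by blast
qed

lemma hermite_gf_unique:
  assumes "hermite_gf H" "hermite_gf G"
  shows "H = G"
proof
  fix m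
  have "poly (H m) x = poly (G m) x" for x
  proof -
    define F where "F H = Abs_fps (\<lambda>m. complex_of_real (poly (H m) x) / fact m)"
      for H :: "nat \<Rightarrow> real poly"
    have sums: "(\<lambda>m. fps_nth (F K) m * z ^ m) sums exp (of_real x * z - z\<^sup>2 / 2)"
      if "hermite_gf K" for K z
      using that by (simp add: hermite_gf_def F_def)
    have ev: "eval_fps (F K) z = exp (of_real x * z - z\<^sup>2 / 2)" if "hermite_gf K" for K z
      using sums[OF that] by (simp add: eval_fps_def sums_iff)
    have "fps_conv_radius (F K) \<ge> norm (1::complex)" if "hermite_gf K" for K
      unfolding fps_conv_radius_def
      by (rule conv_radius_geI) (use sums[OF that, of 1] in \<open>simp add: sums_iff\<close>)
    then have rad: "fps_conv_radius (F K) > 0" if "hermite_gf K" for K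
      using that by (metis ereal_less(2) less_le_trans norm_one zero_less_one)
    have "F H = F G"
      by (rule eval_fps_eqD) (use assms rad ev in auto)
    then have "fps_nth (F H) m = fps_nth (F G) m" by simp
    then show ?thesis by (simp add: F_def)
  qed
  then show "H m = G m" by (simp add: poly_eq_poly_eq_iff[symmetric] fun_eq_iff)
qed

lemma hermite_gf_hermite: "hermite_gf hermite"
  unfolding hermite_def using hermite_gf_exists hermite_gf_unique by (metis theI)

definition locally_uniform_limit ::
    "(nat \<Rightarrow> real \<Rightarrow> complex) \<Rightarrow> (real \<Rightarrow> complex) \<Rightarrow> bool" where
  "locally_uniform_limit f l \<longleftrightarrow>
     (\<forall>x. \<exists>U. open U \<and> x \<in> U \<and> uniform_limit U f l sequentially)"

end

theory Submission
  imports Defs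
begin

text \<open>
  Write \<open>F\<^sub>N z\<close> for the Fourier transform of the standardized distribution at \<open>\<i> z\<close>. The
  polynomials \<open>P N m\<close> and the Hermite polynomials are, up to the factor \<open>m!\<close>, the Taylor
  coefficients at \<open>0\<close> of \<open>exp (x z) / F\<^sub>N z\<close> and of \<open>exp (x z) / exp (z\<^sup>2 / 2)\<close>. The second
  denominator is bounded away from \<open>0\<close> on the disc of radius \<open>r\<close>, so uniform convergence of \<open>F\<^sub>N\<close>
  to it carries over to the reciprocals, and the factor \<open>exp (x z)\<close> is bounded on the disc as long
  as \<open>x\<close> stays in a bounded set (lemma \<open>generating_function_diff_bound\<close>). Cauchy's inequality on
  the circle of radius \<open>r / 2\<close> (lemma \<open>powser_coeff_bound\<close>) then turns closeness of the two
  generating functions into closeness of each coefficient, uniformly for bounded \<open>x\<close>.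

  Cauchy's inequality needs a radius that does not depend on \<open>N\<close>, whereas the generating
  identity holds only on a neighbourhood of \<open>0\<close> that may shrink with \<open>N\<close>. The missing ingredient is
  that \<open>F\<^sub>N\<close> is entire. The Taylor polynomials of \<open>exp (w x)\<close> converge with all derivatives, locally
  uniformly in \<open>x\<close>. Continuity of the distribution therefore allows it to be applied termwise to the
  exponential series (lemma \<open>distribution_exp_sums\<close>), which exhibits the transform as
  an everywhere convergent power series whose coefficients are the moments.
\<close>

section \<open>Iterated derivatives and convergence of smooth functions\<close>

text \<open>A chain of successive derivatives identifies all iterated derivatives at once; this is how
  smoothness is established for polynomials and exponentials below.\<close>

lemma vderiv_chain:
  assumes "\<And>j x. (g j has_vector_derivative g (Suc j) x) (at x)"
  shows "vderiv j (g 0) = g j"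
proof (induction j)
  case 0
  show ?case by (simp add: vderiv_def)
next
  case (Suc j)
  have "vderiv (Suc j) (g 0) = (\<lambda>x. vector_derivative (g j) (at x))"
    using Suc by (simp add: vderiv_def)
  also have "\<dots> = g (Suc j)"
    using assms vector_derivative_at by (intro ext) blast
  finally show ?case .
qed

lemma smooth_chain:
  assumes "\<And>j x. (g j has_vector_derivative g (Suc j) x) (at x)"
  shows "smooth (g 0)"
  unfolding smooth_def vderiv_chain[of g, OF assms]
  using assms differentiableI_vector by blast

lemma smooth_poly: "smooth (\<lambda>x. poly p (of_real x))"
proof -
  define g where "g j = (\<lambda>x. poly ((pderiv ^^ j) p) (complex_of_real x))" for j
  have "(g j has_vector_derivative g (Suc j) x) (at x)" for j x
    unfolding g_def using has_vector_derivative_real_field[OF poly_DERIV] by fastforce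
  from smooth_chain[of g, OF this] show ?thesis by (simp add: g_def)
qed

lemma limitin_smooth_topology:
  assumes l: "smooth l" and f: "\<And>n. smooth (f n)"
    and lim: "\<And>j K. compact K \<Longrightarrow> uniform_limit K (\<lambda>n. vderiv j (f n)) (vderiv j l) F"
  shows "limitin smooth_topology f l F"
  unfolding limitin_def topspace_smooth_topology openin_smooth_topology
proof (intro conjI allI impI)
  show "l \<in> Collect smooth" using l by simp
next
  fix U assume "smooth_open U \<and> l \<in> U"
  then obtain k K e where K: "compact K" "e > 0"
    "\<And>g. smooth g \<Longrightarrow> (\<forall>j\<le>k. \<forall>x\<in>K. norm (vderiv j g x - vderiv j l x) < e) \<Longrightarrow> g \<in> U"
    unfolding smooth_open_def by meson
  have "\<forall>\<^sub>F n in F. \<forall>j\<in>{..k}. \<forall>x\<in>K. dist (vderiv j (f n) x) (vderiv j l x) < e"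
    using lim[OF K(1)] K(2) by (intro eventually_ball_finite) (auto simp: uniform_limit_iff)
  then show "\<forall>\<^sub>F n in F. f n \<in> U"
    by eventually_elim (use K(3) f in \<open>auto simp: dist_norm\<close>)
qed

section \<open>The Fourier transform of a distribution is entire\<close>

definition exp_taylor :: "nat \<Rightarrow> complex \<Rightarrow> complex" where
  "exp_taylor n w = (\<Sum>i<n. w ^ i / fact i)"

lemma exp_taylor_has_derivative:
  "(exp_taylor n has_field_derivative exp_taylor (n - 1) w) (at w)"
proof (induction n)
  case 0
  show ?case by (simp add: exp_taylor_def)
next
  case (Suc n)
  have eq: "exp_taylor (Suc n) = (\<lambda>w. exp_taylor n w + w ^ n / fact n)"
    by (simp add: exp_taylor_def fun_eq_iff)
  have "exp_taylor (n - 1) w + of_nat n * w ^ (n - 1) / fact n = exp_taylor n w"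
    by (cases n) (simp_all add: exp_taylor_def del: of_nat_Suc)
  then show ?case
    unfolding eq by (auto intro!: derivative_eq_intros Suc)
qed

lemma uniform_limit_exp_taylor:
  "uniform_limit (cball 0 R) exp_taylor exp sequentially"
proof -
  have "conv_radius (\<lambda>n. inverse (fact n) :: complex) = \<infinity>"
    by (rule conv_radius_inftyI'')
       (rule summable_exp)
  then have "uniform_limit (cball 0 R) (\<lambda>n w. \<Sum>i<n. inverse (fact i) * (w - 0) ^ i)
      (\<lambda>w::complex. \<Sum>i. inverse (fact i) * (w - 0) ^ i) sequentially"
    by (intro powser_uniform_limit) simp
  moreover have "(\<lambda>n w. \<Sum>i<n. inverse (fact i) * (w - 0) ^ i) = exp_taylor"
    by (simp add: exp_taylor_def fun_eq_iff field_simps)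
  moreover have "(\<lambda>w::complex. \<Sum>i. inverse (fact i) * (w - 0) ^ i) = exp"
    by (simp add: exp_def fun_eq_iff scaleR_conv_of_real)
  ultimately show ?thesis by simp
qed

lemma
  shows vderiv_exp: "vderiv j (\<lambda>x. exp (w * of_real x)) = (\<lambda>x. w ^ j * exp (w * of_real x))"
    and smooth_exp: "smooth (\<lambda>x. exp (w * of_real x))"
proof -
  define g where "g j = (\<lambda>x. w ^ j * exp (w * complex_of_real x))" for j
  have "((\<lambda>z. w ^ j * exp (w * z)) has_field_derivative w ^ Suc j * exp (w * z)) (at z)" for j z
    by (auto intro!: derivative_eq_intros)
  then have "(g j has_vector_derivative g (Suc j) x) (at x)" for j x
    unfolding g_def by (rule has_vector_derivative_real_field)
  from vderiv_chain[of g, OF this] smooth_chain[of g, OF this]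
  show "vderiv j (\<lambda>x. exp (w * of_real x)) = (\<lambda>x. w ^ j * exp (w * of_real x))"
    and "smooth (\<lambda>x. exp (w * of_real x))"
    by (simp_all add: g_def)
qed

text \<open>Differentiation shortens the Taylor polynomial by one term, and the truncated subtraction
  \<open>n - j\<close> correctly yields the zero polynomial once all terms are used up.\<close>

lemma
  shows vderiv_exp_taylor:
      "vderiv j (\<lambda>x. exp_taylor n (w * of_real x)) = (\<lambda>x. w ^ j * exp_taylor (n - j) (w * of_real x))"
    and smooth_exp_taylor: "smooth (\<lambda>x. exp_taylor n (w * of_real x))"
proof -
  define g where "g j = (\<lambda>x. w ^ j * exp_taylor (n - j) (w * complex_of_real x))" for j
  have "((\<lambda>z. w ^ j * exp_taylor (n - j) (w * z)) has_field_derivative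
      w ^ Suc j * exp_taylor (n - Suc j) (w * z)) (at z)" for j z
    by (auto intro!: derivative_eq_intros DERIV_chain'[where g = "exp_taylor (n - j)"]
        exp_taylor_has_derivative)
  then have "(g j has_vector_derivative g (Suc j) x) (at x)" for j x
    unfolding g_def by (rule has_vector_derivative_real_field)
  from vderiv_chain[of g, OF this] smooth_chain[of g, OF this]
  show "vderiv j (\<lambda>x. exp_taylor n (w * of_real x)) = (\<lambda>x. w ^ j * exp_taylor (n - j) (w * of_real x))"
    and "smooth (\<lambda>x. exp_taylor n (w * of_real x))"
    by (simp_all add: g_def)
qed

lemma limitin_exp_taylor:
  "limitin smooth_topology (\<lambda>n x. exp_taylor n (w * of_real x)) (\<lambda>x. exp (w * of_real x)) sequentially"
proof (rule limitin_smooth_topology)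
  fix j and K :: "real set" assume "compact K"
  then obtain R where R: "\<And>x. x \<in> K \<Longrightarrow> norm x \<le> R"
    using compact_imp_bounded bounded_iff by metis
  have "uniform_limit (cball 0 (norm w * R)) (\<lambda>n. exp_taylor (n - j)) exp sequentially"
    by (rule filterlim_compose[OF uniform_limit_exp_taylor filterlim_minus_const_nat_at_top])
  then have "uniform_limit K (\<lambda>n x. exp_taylor (n - j) (w * of_real x))
      (\<lambda>x. exp (w * of_real x)) sequentially"
    by (rule uniform_limit_compose')
       (use R in \<open>auto simp: norm_mult intro!: mult_left_mono\<close>)
  then have "uniform_limit K (\<lambda>n x. w ^ j * exp_taylor (n - j) (w * of_real x))
      (\<lambda>x. w ^ j * exp (w * of_real x)) sequentially"
    by (rule bounded_linear.uniform_limit[OF bounded_linear_mult_right])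
  then show "uniform_limit K (\<lambda>n. vderiv j (\<lambda>x. exp_taylor n (w * of_real x)))
      (vderiv j (\<lambda>x. exp (w * of_real x))) sequentially"
    by (simp add: vderiv_exp vderiv_exp_taylor)
qed (rule smooth_exp smooth_exp_taylor)+

lemma distribution_exp_taylor:
  assumes "cs_distribution \<phi>"
  shows "\<phi> (\<lambda>x. exp_taylor n (w * of_real x)) = (\<Sum>i<n. \<phi> (\<lambda>x. of_real x ^ i) / fact i * w ^ i)"
proof -
  have add: "\<phi> (\<lambda>x. f x + g x) = \<phi> f + \<phi> g" if "smooth f" "smooth g" for f g
    using assms that by (auto simp: cs_distribution_def)
  have scale: "\<phi> (\<lambda>x. c * f x) = c * \<phi> f" if "smooth f" for c f
    using assms that by (auto simp: cs_distribution_def)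
  have monomial: "smooth (\<lambda>x. c * of_real x ^ i)" for c i
    using smooth_poly[of "monom c i"] by (simp add: poly_monom)
  show ?thesis
  proof (induction n)
    case 0
    show ?case using scale[OF monomial[of 1 0], of 0] by (simp add: exp_taylor_def)
  next
    case (Suc n)
    have "(\<lambda>x. exp_taylor (Suc n) (w * of_real x)) =
        (\<lambda>x. exp_taylor n (w * of_real x) + (w ^ n / fact n) * of_real x ^ n)"
      by (simp add: exp_taylor_def fun_eq_iff power_mult_distrib)
    then have "\<phi> (\<lambda>x. exp_taylor (Suc n) (w * of_real x)) =
        \<phi> (\<lambda>x. exp_taylor n (w * of_real x)) + \<phi> (\<lambda>x. (w ^ n / fact n) * of_real x ^ n)"
      by (simp only: add[OF smooth_exp_taylor monomial])
    then show ?case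
      using Suc scale[OF monomial[of 1 n], of "w ^ n / fact n"] by (simp add: mult.commute)
  qed
qed

text \<open>The exponential series converges in the smooth topology, so a distribution may be applied
  to it termwise. The coefficients are the moments of the distribution.\<close>

lemma distribution_exp_sums:
  assumes "cs_distribution \<phi>"
  shows "(\<lambda>i. \<phi> (\<lambda>x. of_real x ^ i) / fact i * w ^ i) sums \<phi> (\<lambda>x. exp (w * of_real x))"
proof -
  have "continuous_map smooth_topology euclidean \<phi>"
    using assms by (simp add: cs_distribution_def)
  from continuous_map_limit[OF this limitin_exp_taylor[of w]]
  have "(\<lambda>n. \<phi> (\<lambda>x. exp_taylor n (w * of_real x))) \<longlonglongrightarrow> \<phi> (\<lambda>x. exp (w * of_real x))"
    by (simp add: o_def)
  then show ?thesis
    by (simp add: sums_def distribution_exp_taylor[OF assms])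
qed

lemma dist_fourier_imaginary: "dist_fourier \<phi> (\<i> * z) = \<phi> (\<lambda>x. exp (z * of_real x))"
  by (simp add: dist_fourier_def flip: mult.assoc)

lemma holomorphic_dist_fourier:
  assumes "cs_distribution \<phi>"
  shows "(\<lambda>z. dist_fourier \<phi> (\<i> * z)) holomorphic_on UNIV"
proof -
  have "(\<lambda>z. dist_fourier \<phi> (\<i> * z)) holomorphic_on ball 0 R" for R
    by (rule power_series_holomorphic[where a = "\<lambda>i. \<phi> (\<lambda>x. of_real x ^ i) / fact i"])
       (use distribution_exp_sums[OF assms] in \<open>simp add: dist_fourier_imaginary\<close>)
  then have "(\<lambda>z. dist_fourier \<phi> (\<i> * z)) holomorphic_on (\<Union>R. ball 0 R)"
    by (intro holomorphic_on_UN_open) auto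
  moreover have "(\<Union>R. ball 0 R) = (UNIV :: complex set)"
    by (auto intro: gt_ex)
  ultimately show ?thesis by simp
qed

text \<open>On exponentials, standardization is a rescaling of the frequency together with a scalar
  factor, so it preserves holomorphy.\<close>

lemma dist_fourier_standardize:
  assumes "cs_distribution \<phi>"
  shows "dist_fourier (standardize \<mu> \<sigma> \<phi>) (\<i> * z) =
    exp (- z * of_real \<mu> / of_real \<sigma>) * dist_fourier \<phi> (\<i> * (z / of_real \<sigma>))"
proof -
  have "exp (z * of_real ((x - \<mu>) / \<sigma>)) =
      exp (- z * of_real \<mu> / of_real \<sigma>) * exp (z / of_real \<sigma> * of_real x)" for x
    by (simp add: diff_divide_distrib algebra_simps flip: exp_add)
  then have "dist_fourier (standardize \<mu> \<sigma> \<phi>) (\<i> * z) =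
      \<phi> (\<lambda>x. exp (- z * of_real \<mu> / of_real \<sigma>) * exp (z / of_real \<sigma> * of_real x))"
    by (simp only: dist_fourier_imaginary standardize_def)
  also have "\<dots> = exp (- z * of_real \<mu> / of_real \<sigma>) * \<phi> (\<lambda>x. exp (z / of_real \<sigma> * of_real x))"
    using assms smooth_exp[of "z / of_real \<sigma>"] unfolding cs_distribution_def by blast
  finally show ?thesis
    by (simp only: dist_fourier_imaginary)
qed

lemma holomorphic_dist_fourier_standardize:
  assumes "cs_distribution \<phi>"
  shows "(\<lambda>z. dist_fourier (standardize \<mu> \<sigma> \<phi>) (\<i> * z)) holomorphic_on A"
proof -
  \<comment> \<open>For \<open>\<sigma> = 0\<close> division by zero makes the inner functions constant.\<close>
  have "(\<lambda>z. z / of_real \<sigma>) holomorphic_on A"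
    by (cases "\<sigma> = 0") (auto intro!: holomorphic_intros)
  then have "(\<lambda>z. dist_fourier \<phi> (\<i> * (z / of_real \<sigma>))) holomorphic_on A"
    using holomorphic_on_compose_gen[OF _ holomorphic_dist_fourier[OF assms] subset_UNIV]
    unfolding o_def by blast
  moreover have "(\<lambda>z. exp (- z * of_real \<mu> / of_real \<sigma>)) holomorphic_on A"
    by (cases "\<sigma> = 0") (auto intro!: holomorphic_intros)
  ultimately show ?thesis
    unfolding dist_fourier_standardize[OF assms] by (intro holomorphic_on_mult)
qed

section \<open>From generating functions to coefficients\<close>

text \<open>The series need only represent \<open>f\<close> near \<open>0\<close>; the bound uses the whole disc on which \<open>f\<close> is
  holomorphic.\<close>

lemma powser_coeff_bound:
  assumes hol: "f holomorphic_on ball 0 r" and \<rho>: "0 < \<rho>" "\<rho> < r"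
    and bound: "\<And>z. norm z < r \<Longrightarrow> norm (f z) \<le> B"
    and sums: "\<forall>\<^sub>F z in nhds 0. (\<lambda>m. a m * z ^ m) sums f z"
  shows "norm (a m :: complex) \<le> B / \<rho> ^ m"
proof -
  have "f has_fps_expansion Abs_fps a"
    using sums by (intro has_fps_expansionI) simp
  then have "a m = (deriv ^^ m) f 0 / fact m"
    using fps_nth_fps_expansion by fastforce
  moreover have "norm ((deriv ^^ m) f 0) \<le> fact m * B / \<rho> ^ m"
  proof (rule Cauchy_inequality)
    have sub: "cball 0 \<rho> \<subseteq> ball 0 r" using \<rho> by auto
    then show "continuous_on (cball 0 \<rho>) f"
      using hol holomorphic_on_imp_continuous_on continuous_on_subset by blast
    show "f holomorphic_on ball 0 \<rho>"
      using hol \<rho> by (auto elim!: holomorphic_on_subset)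
  qed (use \<rho> bound in auto)
  ultimately show ?thesis
    using divide_right_mono[of "norm ((deriv ^^ m) f 0)" _ "fact m"] by (fastforce simp: norm_divide)
qed

lemma norm_inverse_diff_bound:
  fixes a b :: complex
  assumes c: "0 < c" "c \<le> norm a" and e: "norm (b - a) \<le> e" "e \<le> c / 2"
  shows "b \<noteq> 0" and "norm (1 / b - 1 / a) \<le> 2 * e / c\<^sup>2"
proof -
  have b: "c / 2 \<le> norm b"
    using norm_triangle_ineq2[of a b] c e by (simp add: norm_minus_commute)
  then show "b \<noteq> 0" using c by auto
  moreover have "a \<noteq> 0" using c by auto
  ultimately have "norm (1 / b - 1 / a) = norm (b - a) / (norm b * norm a)"
    by (simp add: field_simps norm_minus_commute flip: norm_mult norm_divide)
  also have "\<dots> \<le> e / (c / 2 * c)"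
    using b c e by (intro frac_le mult_mono) (auto intro: order_trans[OF norm_ge_zero])
  finally show "norm (1 / b - 1 / a) \<le> 2 * e / c\<^sup>2"
    by (simp add: power2_eq_square mult.commute)
qed

text \<open>On the disc, \<open>exp (- r\<^sup>2 / 2)\<close> is a lower bound for \<open>norm (exp (z\<^sup>2 / 2))\<close>; its square appears
  below as \<open>exp (- r\<^sup>2)\<close>.\<close>

lemma generating_function_diff_bound:
  fixes x :: real and z b :: complex
  assumes z: "norm z < r" and x: "\<bar>x\<bar> \<le> R"
    and b: "norm (b - exp (z\<^sup>2 / 2)) \<le> e" and e: "e \<le> exp (- r\<^sup>2 / 2) / 2"
  shows "b \<noteq> 0"
    and "norm (exp (of_real x * z) / b - exp (of_real x * z - z\<^sup>2 / 2))
      \<le> exp (R * r) * (2 * e / exp (- r\<^sup>2))"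
proof -
  have "norm (z\<^sup>2 / 2) \<le> r\<^sup>2 / 2"
    using z by (simp add: norm_divide norm_power power_mono)
  then have "- r\<^sup>2 / 2 \<le> Re (z\<^sup>2 / 2)"
    using abs_Re_le_cmod[of "z\<^sup>2 / 2"] by linarith
  then have c: "exp (- r\<^sup>2 / 2) \<le> norm (exp (z\<^sup>2 / 2))"
    by simp
  note inv = norm_inverse_diff_bound[OF exp_gt_zero c b e]
  show "b \<noteq> 0" by (fact inv(1))
  have "\<bar>x\<bar> * norm z \<le> R * r"
    using x z by (intro mult_mono) auto
  then have "Re (of_real x * z) \<le> R * r"
    using complex_Re_le_cmod[of "of_real x * z"] by (simp add: norm_mult)
  then have "norm (exp (of_real x * z)) \<le> exp (R * r)"
    by simp
  moreover have "(exp (- r\<^sup>2 / 2))\<^sup>2 = exp (- r\<^sup>2)"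
    by (simp flip: exp_double)
  ultimately have "norm (exp (of_real x * z) * (1 / b - 1 / exp (z\<^sup>2 / 2)))
      \<le> exp (R * r) * (2 * e / exp (- r\<^sup>2))"
    unfolding norm_mult using inv(2) by (intro mult_mono) auto
  moreover have "exp (of_real x * z) / b - exp (of_real x * z - z\<^sup>2 / 2) =
      exp (of_real x * z) * (1 / b - 1 / exp (z\<^sup>2 / 2))"
    by (simp add: exp_diff right_diff_distrib)
  ultimately show "norm (exp (of_real x * z) / b - exp (of_real x * z - z\<^sup>2 / 2))
      \<le> exp (R * r) * (2 * e / exp (- r\<^sup>2))"
    by simp
qed

lemma generated_poly_hermite_bound:
  fixes x :: real
  assumes gen: "generates_polys \<psi> P"
    and hol: "(\<lambda>z. dist_fourier \<psi> (\<i> * z)) holomorphic_on ball 0 r"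
    and close: "\<And>z. norm z < r \<Longrightarrow> norm (dist_fourier \<psi> (\<i> * z) - exp (z\<^sup>2 / 2)) \<le> e"
    and e: "e \<le> exp (- r\<^sup>2 / 2) / 2"
    and r: "r > 0" and x: "\<bar>x\<bar> \<le> R"
  shows "norm (poly (P m) (of_real x) - of_real (poly (hermite m) x))
    \<le> fact m * (exp (R * r) * (2 * e / exp (- r\<^sup>2)) / (r / 2) ^ m)"
proof -
  define f where "f z = exp (of_real x * z) / dist_fourier \<psi> (\<i> * z) - exp (of_real x * z - z\<^sup>2 / 2)"
    for z
  define a where "a k = (poly (P k) (of_real x) - of_real (poly (hermite k) x)) / fact k" for k
  note bound = generating_function_diff_bound[OF _ x close e]
  have "norm (a m) \<le> exp (R * r) * (2 * e / exp (- r\<^sup>2)) / (r / 2) ^ m"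
  proof (rule powser_coeff_bound[of f r])
    show "f holomorphic_on ball 0 r"
      unfolding f_def using bound(1) by (auto intro!: holomorphic_intros hol)
    show "\<forall>\<^sub>F z in nhds 0. (\<lambda>m. a m * z ^ m) sums f z"
    proof -
      have "\<forall>\<^sub>F z in nhds (0::complex). (\<lambda>m. poly (P m) (of_real x) / fact m * z ^ m) sums
          (exp (of_real x * z) / dist_fourier \<psi> (\<i> * z))"
        using gen by (simp add: generates_polys_def)
      then show ?thesis
      proof eventually_elim
        case (elim z)
        have "(\<lambda>m. of_real (poly (hermite m) x) / fact m * z ^ m) sums exp (of_real x * z - z\<^sup>2 / 2)"
          using hermite_gf_hermite by (simp add: hermite_gf_def)
        from sums_diff[OF elim this] show ?case
          by (simp add: f_def a_def diff_divide_distrib left_diff_distrib)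
      qed
    qed
  qed (use r bound(2) in \<open>auto simp: f_def\<close>)
  then show ?thesis
    by (simp add: a_def norm_divide field_simps)
qed

section \<open>Convergence to the Hermite polynomials\<close>

theorem theorem2p1:
  fixes \<phi> :: "nat \<Rightarrow> (real \<Rightarrow> complex) \<Rightarrow> complex"
    and \<mu> \<sigma> :: "nat \<Rightarrow> real"
    and r :: real
    and P :: "nat \<Rightarrow> nat \<Rightarrow> complex poly"
  assumes distr: "\<And>N. N \<ge> 1 \<Longrightarrow> cs_distribution (\<phi> N)"
    and normalized: "\<And>N. N \<ge> 1 \<Longrightarrow> dist_fourier (\<phi> N) 0 = 1"
    and mean: "\<And>N. N \<ge> 1 \<Longrightarrow> dist_mean (\<phi> N) = of_real (\<mu> N)"
    and variance: "\<And>N. N \<ge> 1 \<Longrightarrow> dist_variance (\<phi> N) = of_real ((\<sigma> N)\<^sup>2)"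
    and sigma_pos: "\<And>N. N \<ge> 1 \<Longrightarrow> \<sigma> N > 0"
    and r_pos: "r > 0"
    and conv: "\<And>\<epsilon>. \<epsilon> > 0 \<Longrightarrow>
      \<exists>N0. \<forall>N>N0. \<forall>z::complex. norm z < r \<longrightarrow>
        norm (dist_fourier (standardize (\<mu> N) (\<sigma> N) (\<phi> N)) (\<i> * z) - exp (z\<^sup>2 / 2)) \<le> \<epsilon>"
    and gen: "\<And>N. N \<ge> 1 \<Longrightarrow> generates_polys (standardize (\<mu> N) (\<sigma> N) (\<phi> N)) (P N)"
  shows "\<forall>m. locally_uniform_limit
           (\<lambda>N x. poly (P N m) (of_real x)) (\<lambda>x. of_real (poly (hermite m) x))"
  unfolding locally_uniform_limit_def
proof (intro allI exI conjI)
  fix m and x0 :: real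
  show "open (ball x0 1)" "x0 \<in> ball x0 1" by simp_all
  define R where "R = \<bar>x0\<bar> + 1"
  \<comment> \<open>The coefficient bound is linear in the distance \<open>e\<close> of the transforms, with slope \<open>A\<close>.\<close>
  define A where "A = fact m * (exp (R * r) * (2 / exp (- r\<^sup>2)) / (r / 2) ^ m)"
  have A: "A > 0" using r_pos by (simp add: A_def)
  show "uniform_limit (ball x0 1) (\<lambda>N x. poly (P N m) (of_real x))
      (\<lambda>x. of_real (poly (hermite m) x)) sequentially"
    unfolding uniform_limit_iff
  proof (intro allI impI)
    fix \<delta> :: real assume \<delta>: "\<delta> > 0"
    define e where "e = min (exp (- r\<^sup>2 / 2) / 2) (\<delta> / (2 * A))"
    have e: "e > 0" "e \<le> exp (- r\<^sup>2 / 2) / 2" "A * e < \<delta>"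
    proof -
      show "e > 0" "e \<le> exp (- r\<^sup>2 / 2) / 2" using A \<delta> by (simp_all add: e_def)
      have "A * e \<le> A * (\<delta> / (2 * A))" using A by (intro mult_left_mono) (auto simp: e_def)
      also have "\<dots> < \<delta>" using A \<delta> by simp
      finally show "A * e < \<delta>" .
    qed
    obtain N0 where N0: "\<And>N z. N > N0 \<Longrightarrow> norm z < r \<Longrightarrow>
        norm (dist_fourier (standardize (\<mu> N) (\<sigma> N) (\<phi> N)) (\<i> * z) - exp (z\<^sup>2 / 2)) \<le> e"
      using conv[OF e(1)] by blast
    show "\<forall>\<^sub>F N in sequentially. \<forall>x\<in>ball x0 1.
        dist (poly (P N m) (of_real x)) (of_real (poly (hermite m) x)) < \<delta>"
      using eventually_gt_at_top[of N0]
    proof eventually_elim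
      case (elim N)
      then have N: "N \<ge> 1" by simp
      show ?case
      proof
        fix x assume "x \<in> ball x0 1"
        then have x: "\<bar>x\<bar> \<le> R" by (auto simp: R_def dist_real_def)
        have "norm (poly (P N m) (of_real x) - of_real (poly (hermite m) x)) \<le> A * e"
          using generated_poly_hermite_bound[OF gen[OF N]
              holomorphic_dist_fourier_standardize[OF distr[OF N]] N0[OF elim] e(2) r_pos x, of m]
          by (simp add: A_def mult_ac)
        then show "dist (poly (P N m) (of_real x)) (of_real (poly (hermite m) x)) < \<delta>"
          using e(3) by (simp add: dist_norm)
      qed
    qed
  qed
qed

end
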